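(* Let $N\ge2$, $m\ge2$, let $y^{(1)},\dots,y^{(m)}\in\mathbb R^{N-1}$ be unit vectors, and let $(\bar x,\bar s)\in P\setminus L^N$. Let $$\bar\delta=\max_{i\ne j}\sqrt{\frac{(y^{(i)})^\top y^{(j)}+1}{2}},\qquad \delta\in[\bar\delta,1),\qquad i^*\in\arg\max_{i}\frac{\bar x^\top y^{(i)}}{\|\bar x\|_2}.$$ If $\dfrac{\bar x^\top y^{(i^* )}}{\|\bar x\|_2}>\delta$, then the optimal solution of $$\max_{y\in\mathbb R^{N-1}}\ y^\top\bar x-\bar s\quad\text{s.t.}\quad \|y\|_2=1,\quad y^\top y^{(i)}\le\delta,\ i=1,\dots,m$$ is $$y^*=\delta y^{(i^* )}+\sqrt{1-\delta^2}\,\frac{(I-y^{(i^* )}(y^{(i^* )})^\top)\bar x}{\|(I-y^{(i^* )}(y^{(i^* )})^\top)\bar x\|_2}.$$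
   Context: The second-order cone is $L^N=\{(x,s)\in\mathbb R^{N-1}\times\mathbb R_+:\|x\|_2\le s\}$, and $P=\{(x,s)\in\mathbb R^{N-1}\times\mathbb R_+:(y^{(i)})^\top x\le s,\ i=1,\dots,m\}\supseteq L^N$ is its current polyhedral relaxation given by the supporting cuts with unit directions $y^{(i)}$. *)

theory Defs
  imports "HOL-Analysis.Analysis"
begin

(* The space R^(N-1) is real ^ 'n with CARD('n) = N - 1; since CARD('n) >= 1 always holds,
   a free type variable 'n covers exactly the dimensions N >= 2. *)

definition second_order_cone :: "((real ^ 'n) \<times> real) set"
  where "second_order_cone = {(x, s). 0 \<le> s \<and> norm x \<le> s}"

definition polyhedral_relaxation ::
    "nat \<Rightarrow> (nat \<Rightarrow> real ^ 'n) \<Rightarrow> ((real ^ 'n) \<times> real) set"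
  where "polyhedral_relaxation m y = {(x, s). 0 \<le> s \<and> (\<forall>i\<in>{1..m}. y i \<bullet> x \<le> s)}"

(* The maximum is over a nonempty finite set only for m >= 2. *)
definition delta_bar :: "nat \<Rightarrow> (nat \<Rightarrow> real ^ 'n) \<Rightarrow> real"
  where "delta_bar m y =
    Max {sqrt ((y i \<bullet> y j + 1) / 2) | i j. i \<in> {1..m} \<and> j \<in> {1..m} \<and> i \<noteq> j}"

definition feasible_direction ::
    "nat \<Rightarrow> (nat \<Rightarrow> real ^ 'n) \<Rightarrow> real \<Rightarrow> real ^ 'n \<Rightarrow> bool"
  where "feasible_direction m y \<delta> z \<longleftrightarrow> norm z = 1 \<and> (\<forall>i\<in>{1..m}. z \<bullet> y i \<le> \<delta>)"

(* The matrix I - u u^T. *)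
definition complement_projection :: "real ^ 'n \<Rightarrow> real ^ 'n ^ 'n"
  where "complement_projection u = mat 1 - (columnvector u :: real ^ 1 ^ 'n) ** (rowvector u :: real ^ 'n ^ 1)"

end

theory Submission
  imports Defs
begin

text \<open>
  Write \<open>u\<close> for the unit vector \<open>y istar\<close> and \<open>w\<close> for the normalised component of \<open>xbar\<close>
  orthogonal to \<open>u\<close>.  On the unit circle of the plane spanned by \<open>u\<close> and \<open>w\<close>, the direction of
  \<open>xbar\<close> lies strictly between \<open>u\<close> and the point \<open>y*\<close> whose angle with \<open>u\<close> has cosine \<open>\<delta>\<close>.
  Hence \<open>xbar = l u + k y*\<close> with \<open>l \<ge> 0\<close> and \<open>k > 0\<close>.  These coefficients are the multipliers of the
  single constraint \<open>z \<bullet> u \<le> \<delta>\<close> and of the normalisation \<open>norm z = 1\<close>: every unit \<open>z\<close> with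
  \<open>z \<bullet> u \<le> \<delta>\<close> satisfies \<open>z \<bullet> xbar \<le> l \<delta> + k = y* \<bullet> xbar\<close>, and equality forces \<open>z = y*\<close>
  (\<open>unique_maximizer_by_multipliers\<close>).

  It remains to see that \<open>y*\<close> respects the other constraints.  By the choice of \<open>delta_bar\<close>, the
  angle between \<open>u\<close> and any other \<open>y i\<close> is at least twice the angle between \<open>u\<close> and \<open>y*\<close>, so the
  triangle inequality for angles keeps \<open>y*\<close> at least as far from \<open>y i\<close> as it is from \<open>u\<close>
  (\<open>rotated_vector_far_from_neighbour\<close>).

  The vector \<open>w\<close> exists because \<open>xbar\<close> cannot be a multiple of \<open>u\<close>: since
  \<open>u \<bullet> xbar > 0\<close>, the multiple would be positive, and then the cut \<open>u \<bullet> xbar \<le> sbar\<close> would put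
  \<open>(xbar, sbar)\<close> in the cone.
\<close>

lemma complement_projection_mult:
  "complement_projection u *v x = x - (u \<bullet> x) *\<^sub>R u"
  by (simp add: complement_projection_def matrix_vector_mult_diff_rdistrib
      flip: matrix_vector_mul_assoc)
     (simp add: vec_eq_iff matrix_vector_mult_def columnvector_def rowvector_def inner_vec_def
      mult.commute)

lemma delta_bar_upper:
  assumes "i \<in> {1..m}" "j \<in> {1..m}" "i \<noteq> j"
  shows "sqrt ((y i \<bullet> y j + 1) / 2) \<le> delta_bar m y"
  unfolding delta_bar_def
proof (rule Max_ge)
  have "{sqrt ((y i \<bullet> y j + 1) / 2) | i j. i \<in> {1..m} \<and> j \<in> {1..m} \<and> i \<noteq> j}
      \<subseteq> (\<lambda>(i, j). sqrt ((y i \<bullet> y j + 1) / 2)) ` ({1..m} \<times> {1..m})"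
    by auto
  then show "finite {sqrt ((y i \<bullet> y j + 1) / 2) | i j. i \<in> {1..m} \<and> j \<in> {1..m} \<and> i \<noteq> j}"
    by (rule finite_subset) simp
qed (use assms in auto)

lemma unit_vectors_inner_ge_1_imp_eq:
  fixes a b :: "'a :: real_inner"
  assumes "norm a = 1" "norm b = 1" "1 \<le> a \<bullet> b"
  shows "a = b"
proof -
  have "(norm (a - b))\<^sup>2 = 2 - 2 * (a \<bullet> b)"
    using assms by (simp add: power2_norm_eq_inner norm_eq_1 inner_diff inner_commute)
  then have "(norm (a - b))\<^sup>2 \<le> 0"
    using assms(3) by simp
  then show ?thesis
    by simp
qed

text \<open>The squared norm of the residual of \<open>v\<close> after projection to the span of \<open>u\<close> and \<open>w\<close> is the
  difference of the two sides.\<close>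

lemma bessel_two:
  fixes u v w :: "'a :: real_inner"
  assumes "norm u = 1" "norm w = 1" "u \<bullet> w = 0"
  shows "(v \<bullet> u)\<^sup>2 + (v \<bullet> w)\<^sup>2 \<le> (norm v)\<^sup>2"
proof -
  define r where "r = v - (v \<bullet> u) *\<^sub>R u - (v \<bullet> w) *\<^sub>R w"
  have "r \<bullet> r = (norm v)\<^sup>2 - (v \<bullet> u)\<^sup>2 - (v \<bullet> w)\<^sup>2"
    using assms unfolding r_def power2_norm_eq_inner
    by (simp add: norm_eq_1 inner_diff inner_commute
        power2_eq_square algebra_simps)
  then show ?thesis
    using inner_ge_zero[of r] by linarith
qed

lemma norm_rotated_vector:
  fixes u w :: "'a :: real_inner"
  assumes "norm u = 1" "norm w = 1" "u \<bullet> w = 0" "\<delta>\<^sup>2 \<le> 1"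
  shows "norm (\<delta> *\<^sub>R u + sqrt (1 - \<delta>\<^sup>2) *\<^sub>R w) = 1"
  using assms
  by (simp add: norm_eq_1 inner_add inner_commute flip: power2_eq_square mult.assoc)

text \<open>
  With angles \<open>\<phi> = arccos \<delta>\<close> and \<open>\<psi>\<close> between \<open>u\<close> and \<open>v\<close>, the hypothesis \<open>half_angle\<close> says
  \<open>\<psi> \<ge> 2 \<phi>\<close>, so rotating \<open>u\<close> by \<open>\<phi>\<close> in any direction leaves an angle of at least
  \<open>\<psi> - \<phi> \<ge> \<phi>\<close> to \<open>v\<close>.
\<close>

lemma rotated_vector_far_from_neighbour:
  fixes u v w :: "'a :: real_inner"
  assumes u: "norm u = 1" and w: "norm w = 1" and v: "norm v = 1" and orth: "u \<bullet> w = 0"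
    and \<delta>: "0 \<le> \<delta>" "\<delta> < 1" and half_angle: "(v \<bullet> u + 1) / 2 \<le> \<delta>\<^sup>2"
  shows "(\<delta> *\<^sub>R u + sqrt (1 - \<delta>\<^sup>2) *\<^sub>R w) \<bullet> v \<le> \<delta>"
proof -
  define p where "p = v \<bullet> u"
  define q where "q = v \<bullet> w"
  have \<delta>2: "\<delta>\<^sup>2 < 1"
    using \<delta> by (simp add: abs_square_less_1)
  have p: "p + 1 \<le> 2 * \<delta>\<^sup>2"
    using half_angle by (simp add: p_def)
  then have p1: "0 \<le> 1 - p"
    using \<delta>2 by linarith
  have "q\<^sup>2 \<le> 1 - p\<^sup>2"
    using bessel_two[OF u w orth, of v] v by (simp add: p_def q_def)
  then have "(sqrt (1 - \<delta>\<^sup>2) * q)\<^sup>2 \<le> (1 - \<delta>\<^sup>2) * (1 - p\<^sup>2)"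
    using \<delta>2 by (simp add: power_mult_distrib mult_left_mono)
  also have "\<dots> = (1 - p) * ((1 - \<delta>\<^sup>2) * (1 + p))"
    by (simp add: power2_eq_square algebra_simps)
  also have "\<dots> \<le> (1 - p) * (\<delta>\<^sup>2 * (1 - p))"
    using p by (intro mult_left_mono p1) (simp add: algebra_simps)
  also have "\<dots> = (\<delta> * (1 - p))\<^sup>2"
    by (simp add: power2_eq_square algebra_simps)
  finally have "sqrt (1 - \<delta>\<^sup>2) * q \<le> \<delta> * (1 - p)"
    by (rule power2_le_imp_le) (intro mult_nonneg_nonneg \<delta>(1) p1)
  then show ?thesis
    by (simp add: p_def q_def inner_add inner_commute algebra_simps)
qed

text \<open>
  Weak duality for the linear objective \<open>z \<bullet> x\<close>: \<open>l\<close> is the multiplier of \<open>z \<bullet> u \<le> \<delta>\<close>, which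
  \<open>v\<close> satisfies with equality, and \<open>k\<close> that of the unit sphere, on which \<open>z \<bullet> v\<close> is largest
  at \<open>v\<close> only.
\<close>

lemma unique_maximizer_by_multipliers:
  fixes u v x z :: "'a :: real_inner"
  assumes x: "x = l *\<^sub>R u + k *\<^sub>R v" and "0 \<le> l" "0 < k"
    and v: "norm v = 1" "v \<bullet> u = \<delta>" and z: "norm z = 1" "z \<bullet> u \<le> \<delta>"
  shows "z \<bullet> x \<le> v \<bullet> x" and "v \<bullet> x \<le> z \<bullet> x \<Longrightarrow> z = v"
proof -
  have gap: "v \<bullet> x - z \<bullet> x = l * (\<delta> - z \<bullet> u) + k * (1 - z \<bullet> v)"
    using v by (simp add: x inner_add norm_eq_1 algebra_simps)
  have slack: "0 \<le> l * (\<delta> - z \<bullet> u)"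
    using \<open>0 \<le> l\<close> z by simp
  have "z \<bullet> v \<le> 1"
    using norm_cauchy_schwarz[of z v] v z by simp
  then have "0 \<le> k * (1 - z \<bullet> v)"
    using \<open>0 < k\<close> by simp
  with gap slack show "z \<bullet> x \<le> v \<bullet> x"
    by linarith
  assume "v \<bullet> x \<le> z \<bullet> x"
  with gap slack have "k * (1 - z \<bullet> v) \<le> 0"
    by linarith
  then have "1 \<le> z \<bullet> v"
    using \<open>0 < k\<close> by (simp add: mult_le_0_iff)
  then show "z = v"
    by (rule unit_vectors_inner_ge_1_imp_eq[OF z(1) v(1)])
qed

text \<open>
  The condition \<open>\<delta> * norm x < a\<close> says that \<open>x\<close> makes a smaller angle with \<open>u\<close> than the rotated
  vector does, so \<open>x\<close> lies in the cone generated by these two vectors.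
\<close>

lemma in_cone_of_rotated_vector:
  fixes u w x :: "'a :: real_inner"
  assumes u: "norm u = 1" and w: "norm w = 1" and orth: "u \<bullet> w = 0"
    and \<delta>: "0 \<le> \<delta>" "\<delta> < 1"
    and x: "x = a *\<^sub>R u + b *\<^sub>R w" and b: "0 < b" and angle: "\<delta> * norm x < a"
  obtains l k where "0 \<le> l" "0 < k"
    "x = l *\<^sub>R u + k *\<^sub>R (\<delta> *\<^sub>R u + sqrt (1 - \<delta>\<^sup>2) *\<^sub>R w)"
proof
  define s where "s = sqrt (1 - \<delta>\<^sup>2)"
  have \<delta>2: "\<delta>\<^sup>2 < 1"
    using \<delta> by (simp add: abs_square_less_1)
  then have s: "0 < s" "s\<^sup>2 = 1 - \<delta>\<^sup>2"
    by (simp_all add: s_def)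
  have a: "0 \<le> a"
    using angle \<delta> by (smt (verit) mult_nonneg_nonneg norm_ge_zero)
  have norm_x: "(norm x)\<^sup>2 = a\<^sup>2 + b\<^sup>2"
    using u w orth unfolding x power2_norm_eq_inner
    by (simp add: norm_eq_1 inner_add inner_commute power2_eq_square)
  have "(\<delta> * norm x)\<^sup>2 \<le> a\<^sup>2"
    using angle \<delta> by (intro power_mono) auto
  then have "(\<delta> * b)\<^sup>2 \<le> (s * a)\<^sup>2"
    by (simp add: power_mult_distrib norm_x s algebra_simps)
  then have "\<delta> * b \<le> s * a"
    by (rule power2_le_imp_le) (use s a in simp)
  then show "0 \<le> a - \<delta> * b / s"
    using s by (simp add: field_simps)
  show "0 < b / s"
    using b s by simp
  show "x = (a - \<delta> * b / s) *\<^sub>R u + (b / s) *\<^sub>R (\<delta> *\<^sub>R u + sqrt (1 - \<delta>\<^sup>2) *\<^sub>R w)"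
    using s by (simp add: x algebra_simps flip: s_def)
qed

text \<open>On the ray spanned by a cut direction, the cut coincides with the cone constraint, so a
  point of the relaxation outside the cone cannot lie there.\<close>

lemma complement_projection_nonzero:
  assumes mem: "(x, s) \<in> polyhedral_relaxation m y - second_order_cone"
    and i: "i \<in> {1..m}" and unit: "norm (y i) = 1" and nonobtuse: "0 \<le> y i \<bullet> x"
  shows "complement_projection (y i) *v x \<noteq> 0"
proof
  assume "complement_projection (y i) *v x = 0"
  then have "x = (y i \<bullet> x) *\<^sub>R y i"
    by (simp add: complement_projection_mult)
  then have "norm x = norm ((y i \<bullet> x) *\<^sub>R y i)"
    by (rule arg_cong)
  then have "norm x = y i \<bullet> x"
    using unit nonobtuse by simp
  then show False
    using mem i by (auto simp: polyhedral_relaxation_def second_order_cone_def)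
qed

theorem theorem2p8:
  fixes m :: nat
    and y :: "nat \<Rightarrow> real ^ 'n"
    and xbar :: "real ^ 'n"
    and sbar \<delta> :: real
    and istar :: nat
  assumes "m \<ge> 2"
    and "\<And>i. i \<in> {1..m} \<Longrightarrow> norm (y i) = 1"
    and "(xbar, sbar) \<in> polyhedral_relaxation m y - second_order_cone"
    and "\<delta> \<in> {delta_bar m y..<1}"
    and "is_arg_max (\<lambda>i. (xbar \<bullet> y i) / norm xbar) (\<lambda>i. i \<in> {1..m}) istar"
    and "(xbar \<bullet> y istar) / norm xbar > \<delta>"
  shows "{z. is_arg_max (\<lambda>z. z \<bullet> xbar - sbar) (feasible_direction m y \<delta>) z} =
    {\<delta> *\<^sub>R y istar +
      sqrt (1 - \<delta>\<^sup>2) *\<^sub>R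
        ((complement_projection (y istar) *v xbar) /\<^sub>R
          norm (complement_projection (y istar) *v xbar))}"
proof -
  define u where "u = y istar"
  define r where "r = complement_projection u *v xbar"
  define w where "w = r /\<^sub>R norm r"
  define v where "v = \<delta> *\<^sub>R u + sqrt (1 - \<delta>\<^sup>2) *\<^sub>R w"
  have istar: "istar \<in> {1..m}"
    using assms(5) by (simp add: is_arg_max_def)
  have u: "norm u = 1"
    using assms(2)[OF istar] by (simp add: u_def)
  have \<delta>1: "\<delta> < 1"
    using assms(4) by simp
  have half_angle: "sqrt ((y i \<bullet> u + 1) / 2) \<le> \<delta>" if "i \<in> {1..m}" "i \<noteq> istar" for i
    using delta_bar_upper[OF that(1) istar that(2), of y] assms(4) by (simp add: u_def)
  have inner_ge: "0 \<le> (y i \<bullet> u + 1) / 2" if "i \<in> {1..m}" for i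
    using Cauchy_Schwarz_ineq2[of "y i" u] assms(2)[OF that] u by simp
  \<comment> \<open>A second index is needed to conclude that \<open>\<delta>\<close> is nonnegative.\<close>
  obtain j where j: "j \<in> {1..m}" "j \<noteq> istar"
  proof (cases "istar = 1")
    case True
    then show ?thesis using that[of 2] assms(1) by simp
  next
    case False
    then show ?thesis using that[of 1] assms(1) by simp
  qed
  have \<delta>0: "0 \<le> \<delta>"
    using half_angle[OF j] inner_ge[OF j(1)] by (meson order_trans real_sqrt_ge_zero)
  have xbar: "xbar \<noteq> 0"
    using assms(6) \<delta>0 by auto
  then have angle: "\<delta> * norm xbar < u \<bullet> xbar"
    using assms(6) by (simp add: u_def pos_less_divide_eq inner_commute)
  then have nonobtuse: "0 \<le> u \<bullet> xbar"
    using \<delta>0 by (smt (verit) mult_nonneg_nonneg norm_ge_zero)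
  have r: "r \<noteq> 0"
    using complement_projection_nonzero[OF assms(3) istar] u nonobtuse
    by (simp add: r_def u_def)
  then have w: "norm w = 1"
    by (simp add: w_def)
  have "u \<bullet> r = 0"
    using u by (simp add: r_def complement_projection_mult inner_diff norm_eq_1)
  then have orth: "u \<bullet> w = 0"
    by (simp add: w_def)
  have decomp: "xbar = (u \<bullet> xbar) *\<^sub>R u + norm r *\<^sub>R w"
    using r by (simp add: w_def) (simp add: r_def complement_projection_mult)
  obtain l k where lk: "0 \<le> l" "0 < k" "xbar = l *\<^sub>R u + k *\<^sub>R v"
    using in_cone_of_rotated_vector[OF u w orth \<delta>0 \<delta>1 decomp _ angle] r
    unfolding v_def by auto
  have v: "norm v = 1"
    unfolding v_def using \<delta>0 \<delta>1
    by (intro norm_rotated_vector u w orth) (simp add: abs_square_le_1)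
  have vu: "v \<bullet> u = \<delta>"
    using u orth by (simp add: v_def inner_add norm_eq_1 inner_commute)
  have "v \<bullet> y i \<le> \<delta>" if i: "i \<in> {1..m}" for i
  proof (cases "i = istar")
    case True
    then show ?thesis using vu by (simp add: u_def)
  next
    case False
    have "(y i \<bullet> u + 1) / 2 \<le> \<delta>\<^sup>2"
      using half_angle[OF i False] by (rule sqrt_le_D)
    then show ?thesis
      unfolding v_def
      by (intro rotated_vector_far_from_neighbour u w orth \<delta>0 \<delta>1 assms(2) i)
  qed
  with v have feas: "feasible_direction m y \<delta> v"
    by (simp add: feasible_direction_def)
  have max: "z \<bullet> xbar \<le> v \<bullet> xbar" and uniq: "v \<bullet> xbar \<le> z \<bullet> xbar \<Longrightarrow> z = v"
    if "feasible_direction m y \<delta> z" for z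
  proof -
    have "norm z = 1" "z \<bullet> u \<le> \<delta>"
      using that istar by (auto simp: feasible_direction_def u_def)
    note bound = unique_maximizer_by_multipliers[OF lk(3,1,2) v vu this]
    show "z \<bullet> xbar \<le> v \<bullet> xbar"
      by (rule bound)
    show "v \<bullet> xbar \<le> z \<bullet> xbar \<Longrightarrow> z = v"
      by (rule bound)
  qed
  have "{z. is_arg_max (\<lambda>z. z \<bullet> xbar - sbar) (feasible_direction m y \<delta>) z} = {v}"
    using feas max uniq by (auto simp: is_arg_max_linorder)
  then show ?thesis
    by (simp only: v_def w_def r_def u_def)
qed

end
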